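(* Let $n_0, N, M, U$ be positive integers with $U\le M$, let $\nu\in(0,1)$, and let $\Lambda(x)=\sum_L \Lambda_L x^L$ be a degree distribution. Consider the per-slot discarding decoder (described in the context) applied to a degree-$U$ slot, where the codebook has $M$ codewords, each consisting of a pilot symbol $1$ followed by $n_0$ i.i.d. Bernoulli($\nu$) symbols. The probability $\pi_U$ that this decoder resolves the slot is $$\pi_U = \mathbb{E}\left[\left(1-\frac{\Lambda'(1)}{N}\,\nu^{\mathsf{A}_U}(1-\nu)^{\mathsf{A}_0}\right)^{M-U}\right],$$ where $\mathsf{A}_0$ and $\mathsf{A}_U$ are random nonnegative integers with joint probability mass function $$\mathbb{P}[\mathsf{A}_0=A_0,\mathsf{A}_U=A_U] = \frac{n_0!}{A_0!\,A_U!\,(n_0-A_0-A_U)!}\,(1-\nu)^{UA_0}\,\nu^{UA_U}\,\bigl(1-(1-\nu)^U-\nu^U\bigr)^{n_0-A_0-A_U}$$ for nonnegative integers $A_0,A_U$ with $A_0+A_U\le n_0$. In particular, if $\nu=0.5$, then $$\pi_U = \mathbb{E}\left[\left(1-\frac{\Lambda'(1)}{N}\,2^{-\mathsf{A}}\right)^{M-U}\right] \ \ge\ \pi_U' := \left(1-\frac{\Lambda'(1)}{N}\bigl(1-2^{-U}\bigr)^{n_0}\right)^{M-U},$$ where $\mathsf{A}\sim\mathrm{Bino}(n_0,2^{1-U})$.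
   Context: Binary adder channel with slotted transmission. A frame has $N$ slots, each of $n_0+1$ channel uses. A codebook has $M$ codewords $\boldsymbol c_1,\dots,\boldsymbol c_M\in\{0,1\}^{n_0+1}$: the first entry of each is $1$ (pilot), and the remaining $n_0$ entries are i.i.d., equal to $1$ with probability $\nu$ and $0$ with probability $1-\nu$. The codewords are treated as mutually independent. In irregular repetition slotted ALOHA (IRSA) with degree distribution $\Lambda(x)=\sum_L\Lambda_L x^L$ (a probability distribution on positive integers $L\le N$; $\Lambda'(1)=\sum_L L\Lambda_L$ is the mean degree), each codeword is associated with a random number $\mathsf L$ of slots, $\mathbb P[\mathsf L=L]=\Lambda_L$, chosen uniformly without replacement among the $N$ slots, independently across codewords and independently of the codeword symbols. So a given codeword is associated with a given slot with probability $\Lambda'(1)/N$. An active user transmits its codeword in all slots associated with it. A slot has degree $U$ if exactly $U$ codewords (of $U$ distinct users) are transmitted in it. The receiver observes the entrywise integer sum $\boldsymbol y$ of the transmitted codewords; its first entry equals $U$, so $U$ is known to the receiver. The candidate list of the slot is the set of all codewords associated with the slot: it contains the $U$ transmitted ones, and each of the $M-U$ nontransmitted codewords belongs to it independently with probability $\Lambda'(1)/N$. Per-slot discarding decoder: for each channel use $j\in\{2,\dots,n_0+1\}$, if $y(j)=U$, discard from the candidate list all codewords $\boldsymbol c$ with $c(j)=0$; if $y(j)=0$, discard all codewords $\boldsymbol c$ with $c(j)=1$. The slot is resolved if exactly $U$ codewords survive in the list, i.e. no nontransmitted codeword survives. The probability $\pi_U$ is over the random codebook and the random slot associations. $\mathrm{Bino}(n,p)$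 is the binomial distribution. Convention: $0^0=1$. *)

theory Defs
  imports "HOL-Probability.Probability" "HOL-Computational_Algebra.Polynomial"
begin

text \<open>
  Codewords are indexed by \<open>{1..M}\<close>, channel uses by \<open>{1..n0 + 1}\<close> (the first one carries the
  pilot), and slots by \<open>{1..N}\<close>. Symbols are the natural numbers 0 and 1, so that the channel
  output is an ordinary integer sum.
\<close>

definition codeword_pmf :: "nat \<Rightarrow> real \<Rightarrow> (nat \<Rightarrow> nat) pmf" where
  "codeword_pmf n0 \<nu> =
     Pi_pmf {1..n0 + 1} 0
       (\<lambda>j. if j = 1 then return_pmf 1 else map_pmf of_bool (bernoulli_pmf \<nu>))"

definition slots_pmf :: "nat \<Rightarrow> nat pmf \<Rightarrow> nat set pmf" where
  "slots_pmf N \<Lambda> = bind_pmf \<Lambda> (\<lambda>L. pmf_of_set {A. A \<subseteq> {1..N} \<and> card A = L})"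

text \<open>A sample is a pair of a codebook \<open>c\<close> and the slot sets \<open>S\<close>: \<open>c i j\<close> is symbol \<open>j\<close> of
  codeword \<open>i\<close>, and \<open>S i\<close> is the set of slots associated with codeword \<open>i\<close>.\<close>

definition system_pmf ::
  "nat \<Rightarrow> nat \<Rightarrow> nat \<Rightarrow> real \<Rightarrow> nat pmf \<Rightarrow> ((nat \<Rightarrow> nat \<Rightarrow> nat) \<times> (nat \<Rightarrow> nat set)) pmf" where
  "system_pmf n0 N M \<nu> \<Lambda> =
     pair_pmf (Pi_pmf {1..M} (\<lambda>_. 0) (\<lambda>_. codeword_pmf n0 \<nu>))
              (Pi_pmf {1..M} {} (\<lambda>_. slots_pmf N \<Lambda>))"

definition degree_poly :: "nat \<Rightarrow> nat pmf \<Rightarrow> real poly" where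
  "degree_poly N \<Lambda> = (\<Sum>L=1..N. monom (pmf \<Lambda> L) L)"

definition mean_degree :: "nat \<Rightarrow> nat pmf \<Rightarrow> real" where
  "mean_degree N \<Lambda> = poly (pderiv (degree_poly N \<Lambda>)) 1"

definition received :: "(nat \<Rightarrow> nat \<Rightarrow> nat) \<Rightarrow> nat set \<Rightarrow> nat \<Rightarrow> nat" where
  "received c T j = (\<Sum>i\<in>T. c i j)"

definition candidates :: "nat \<Rightarrow> (nat \<Rightarrow> nat set) \<Rightarrow> nat \<Rightarrow> nat set" where
  "candidates M S s = {i \<in> {1..M}. s \<in> S i}"

text \<open>The decoder sees the codebook, the candidate list and the channel output \<open>y\<close>; it reads the
  slot degree off the pilot position \<open>y 1\<close>. Lists hold codeword indices, so a nontransmitted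
  codeword whose symbols happen to agree with those of a transmitted one counts separately.\<close>

definition survivors ::
  "nat \<Rightarrow> (nat \<Rightarrow> nat \<Rightarrow> nat) \<Rightarrow> nat set \<Rightarrow> (nat \<Rightarrow> nat) \<Rightarrow> nat set" where
  "survivors n0 c C y =
     C - (\<Union>j\<in>{2..n0 + 1}.
            {i. y j = y 1 \<and> c i j = 0} \<union> {i. y j = 0 \<and> c i j = 1})"

definition resolved ::
  "nat \<Rightarrow> nat \<Rightarrow> nat set \<Rightarrow> nat \<Rightarrow> (nat \<Rightarrow> nat \<Rightarrow> nat) \<Rightarrow> (nat \<Rightarrow> nat set) \<Rightarrow> bool" where
  "resolved n0 M T s c S \<longleftrightarrow>
     card (survivors n0 c (candidates M S s) (received c T)) = card T"

text \<open>The probability that slot \<open>s\<close> is resolved when the codewords transmitted in it are those with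
  indices in \<open>T\<close>. A codeword is transmitted only in slots associated with it, hence the conditioning;
  the associations of the nontransmitted codewords keep their unconditional law.\<close>

definition resolve_prob ::
  "nat \<Rightarrow> nat \<Rightarrow> nat \<Rightarrow> real \<Rightarrow> nat pmf \<Rightarrow> nat set \<Rightarrow> nat \<Rightarrow> real" where
  "resolve_prob n0 N M \<nu> \<Lambda> T s =
     \<P>(\<omega> in measure_pmf (system_pmf n0 N M \<nu> \<Lambda>).
         resolved n0 M T s (fst \<omega>) (snd \<omega>) \<bar> (\<forall>i\<in>T. s \<in> snd \<omega> i))"

end

theory Submission
  imports Defs
begin

text \<open>
  Given the whole codebook, the slot associations are independent, so conditionally on the
  transmitted set being associated with the slot, it is resolved with probability
  \<open>(1 - p)\<^sup>k\<close>, where \<open>p\<close> is the mean degree over \<open>N\<close> and \<open>k\<close> counts the nontransmitted codewords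
  compatible with the output. These codewords are independent of the transmitted ones, hence
  averaging over them turns each factor into \<open>1 - p \<nu> ^ A\<^sub>U (1 - \<nu>) ^ A\<^sub>0\<close>, where \<open>A\<^sub>0\<close> and \<open>A\<^sub>U\<close> count
  the channel uses in which all transmitted symbols are 0, respectively 1. Reading the transmitted
  codewords column by column, these counts are trinomial. For \<open>\<nu> = 1/2\<close> only their
  binomial sum matters, and the bound is Jensen's inequality for a power.
\<close>

section \<open>Mixtures and products of discrete distributions\<close>

lemma measure_bind_pmf:
  "measure_pmf.prob (bind_pmf p f) X = measure_pmf.expectation p (\<lambda>x. measure_pmf.prob (f x) X)"
  unfolding measure_pmf_bind
  by (intro measure_pmf.measure_bind[where N = "count_space UNIV"])
    (auto simp: measure_subprob)

text \<open>Finite supports turn both sides into finite sums, so no integrability of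
  \<open>f\<close> has to be checked.\<close>

lemma expectation_pair_pmf:
  fixes f :: "'a \<times> 'b \<Rightarrow> real"
  assumes "finite (set_pmf p)" "finite (set_pmf q)"
  shows "measure_pmf.expectation (pair_pmf p q) f =
    measure_pmf.expectation p (\<lambda>x. measure_pmf.expectation q (\<lambda>y. f (x, y)))"
proof -
  have "measure_pmf.expectation (pair_pmf p q) f =
      (\<Sum>(x, y)\<in>set_pmf p \<times> set_pmf q. pmf p x * (pmf q y * f (x, y)))"
    using assms by (subst integral_measure_pmf[where A = "set_pmf p \<times> set_pmf q"])
      (auto simp: pmf_pair mult_ac intro!: sum.cong)
  also have "\<dots> = (\<Sum>x\<in>set_pmf p. pmf p x * (\<Sum>y\<in>set_pmf q. pmf q y * f (x, y)))"
    by (simp add: sum.cartesian_product sum_distrib_left)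
  also have "\<dots> = measure_pmf.expectation p (\<lambda>x. measure_pmf.expectation q (\<lambda>y. f (x, y)))"
    using assms by (simp add: integral_measure_pmf[where A = "set_pmf p"]
        integral_measure_pmf[where A = "set_pmf q"])
  finally show ?thesis .
qed

lemma measure_pair_pmf:
  "measure_pmf.prob (pair_pmf p q) X =
    measure_pmf.expectation p (\<lambda>x. measure_pmf.prob q {y. (x, y) \<in> X})"
proof -
  have "pair_pmf p q = bind_pmf p (\<lambda>x. map_pmf (Pair x) q)"
    by (simp add: pair_pmf_def map_pmf_def)
  then show ?thesis
    by (simp add: measure_bind_pmf vimage_def)
qed

lemma finite_set_Pi_pmf:
  assumes "finite I" "\<And>i. i \<in> I \<Longrightarrow> finite (set_pmf (p i))"
  shows "finite (set_pmf (Pi_pmf I d p))"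
  using assms by (simp add: set_Pi_pmf finite_PiE_dflt)

text \<open>A codebook is drawn row by row (one row per codeword), while the channel acts on
  columns. Both laws give a matrix the product of its entry masses, so swapping the two products
  lets the codebook be drawn column by column.\<close>

lemma Pi_pmf_transpose:
  assumes "finite I" "finite J"
  shows "map_pmf (\<lambda>c j i. c i j) (Pi_pmf I (\<lambda>_. d) (\<lambda>i. Pi_pmf J d (p i))) =
    Pi_pmf J (\<lambda>_. d) (\<lambda>j. Pi_pmf I d (\<lambda>i. p i j))"
proof (rule pmf_eqI)
  fix g :: "'b \<Rightarrow> 'a \<Rightarrow> 'c"
  let ?t = "\<lambda>c j i. c i j :: 'c" and ?c = "\<lambda>i j. g j i"
  have "inj (?t :: ('a \<Rightarrow> 'b \<Rightarrow> 'c) \<Rightarrow> _)"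
    by (auto simp: inj_def fun_eq_iff)
  from pmf_map_inj'[OF this, of _ ?c]
  have "pmf (map_pmf ?t (Pi_pmf I (\<lambda>_. d) (\<lambda>i. Pi_pmf J d (p i)))) g =
      pmf (Pi_pmf I (\<lambda>_. d) (\<lambda>i. Pi_pmf J d (p i))) ?c"
    by simp
  \<comment> \<open>A matrix with an entry other than \<open>d\<close> outside the index rectangle
    has mass 0: either its row lies outside \<open>I\<close>, or the inner law of that row
    contributes a zero factor.\<close>
  also have "\<dots> = (if \<forall>i j. i \<notin> I \<or> j \<notin> J \<longrightarrow> g j i = d
      then \<Prod>i\<in>I. \<Prod>j\<in>J. pmf (p i j) (g j i) else 0)"
    using assms by (auto simp: pmf_Pi fun_eq_iff intro!: prod.cong prod_zero)
  also have "\<dots> = (if \<forall>i j. i \<notin> I \<or> j \<notin> J \<longrightarrow> g j i = d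
      then \<Prod>j\<in>J. \<Prod>i\<in>I. pmf (p i j) (g j i) else 0)"
    by (subst prod.swap) simp
  also have "\<dots> = pmf (Pi_pmf J (\<lambda>_. d) (\<lambda>j. Pi_pmf I d (\<lambda>i. p i j))) g"
    using assms by (auto simp: pmf_Pi fun_eq_iff intro!: prod.cong prod_zero)
  finally show "pmf (map_pmf ?t (Pi_pmf I (\<lambda>_. d) (\<lambda>i. Pi_pmf J d (p i)))) g =
    pmf (Pi_pmf J (\<lambda>_. d) (\<lambda>j. Pi_pmf I d (\<lambda>i. p i j))) g" .
qed

section \<open>Trinomial and binomial laws, and Jensen's inequality\<close>

text \<open>Split by the set \<open>A\<close> of coordinates with \<open>P\<close> and the set
  \<open>B\<close> with \<open>Q\<close>: by independence each admissible choice has the same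
  probability, and counting the choices gives two binomial coefficients. Coordinates outside
  \<open>J\<close> stay free, which later accommodates the pilot.\<close>

lemma trinomial_Pi_pmf:
  fixes p :: "'a \<Rightarrow> 'b pmf" and P Q :: "'b \<Rightarrow> bool"
  assumes I: "finite I" "J \<subseteq> I" and disj: "\<And>x. \<not> (P x \<and> Q x)"
    and P: "\<And>j. j \<in> J \<Longrightarrow> measure_pmf.prob (p j) {x. P x} = u"
    and Q: "\<And>j. j \<in> J \<Longrightarrow> measure_pmf.prob (p j) {x. Q x} = v"
  shows "measure_pmf.prob (Pi_pmf I d p) {g. card {j\<in>J. P (g j)} = a \<and> card {j\<in>J. Q (g j)} = b} =
    (if a + b \<le> card J
     then fact (card J) / (fact a * fact b * fact (card J - a - b))
       * u ^ a * v ^ b * (1 - u - v) ^ (card J - a - b) else 0)"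
    (is "?lhs = _")
proof -
  let ?Pi = "Pi_pmf I d p" and ?n = "card J"
  have fin: "finite J" using I finite_subset by blast
  define E where "E = (\<lambda>A B. {g. {j\<in>J. P (g j)} = A \<and> {j\<in>J. Q (g j)} = B})"
  define S where "S = (\<lambda>X k. {A. A \<subseteq> (X :: 'a set) \<and> card A = k})"
  have finS: "finite (S X k)" if "finite X" for X k
    using that by (simp add: S_def)
  have neither: "measure_pmf.prob (p j) {x. \<not> P x \<and> \<not> Q x} = 1 - u - v" if "j \<in> J" for j
  proof -
    have "measure_pmf.prob (p j) ({x. P x} \<union> {x. Q x}) = u + v"
      using disj P[OF that] Q[OF that] by (subst measure_pmf.finite_measure_Union) auto
    moreover have "{x. \<not> P x \<and> \<not> Q x} = - ({x. P x} \<union> {x. Q x})" by auto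
    ultimately show ?thesis
      using measure_pmf.prob_compl[of "{x. P x} \<union> {x. Q x}" "p j"]
      by (simp add: Compl_eq_Diff_UNIV)
  qed
  have E: "measure_pmf.prob ?Pi (E A B) = u ^ a * v ^ b * (1 - u - v) ^ (?n - a - b)"
    if A: "A \<in> S J a" and B: "B \<in> S (J - A) b" for A B
  proof -
    have sub: "A \<subseteq> J" "B \<subseteq> J" "A \<inter> B = {}" "card A = a" "card B = b"
      using A B by (auto simp: S_def)
    have finAB: "finite A" "finite B"
      using sub fin finite_subset by auto
    let ?w = "\<lambda>j. if j \<in> A then u else if j \<in> B then v else 1 - u - v"
    let ?F = "\<lambda>j. if j \<in> J then {x. (P x \<longleftrightarrow> j \<in> A) \<and> (Q x \<longleftrightarrow> j \<in> B)} else UNIV"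
    have "E A B = Pi I ?F"
      using I(2) sub unfolding E_def Pi_def by (auto split: if_splits) (metis subsetD)+
    then have "measure_pmf.prob ?Pi (E A B) = (\<Prod>j\<in>I. measure_pmf.prob (p j) (?F j))"
      using I by (simp add: measure_Pi_pmf_Pi)
    also have "\<dots> = (\<Prod>j\<in>J. measure_pmf.prob (p j) (?F j))"
      using I by (intro prod.mono_neutral_right) auto
    also have "\<dots> = (\<Prod>j\<in>J. ?w j)"
    proof (rule prod.cong[OF refl])
      fix j assume j: "j \<in> J"
      have "{x. P x \<and> \<not> Q x} = {x. P x}" "{x. \<not> P x \<and> Q x} = {x. Q x}"
        using disj by auto
      then show "measure_pmf.prob (p j) (?F j) = ?w j"
        using j sub P[OF j] Q[OF j] neither[OF j] by auto
    qed
    also have "J = A \<union> B \<union> (J - A - B)"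
      using sub by auto
    also have "(\<Prod>j\<in>\<dots>. ?w j) = (\<Prod>j\<in>A. ?w j) * (\<Prod>j\<in>B. ?w j) * (\<Prod>j\<in>J - A - B. ?w j)"
      using sub finAB fin by (subst prod.union_disjoint; (subst prod.union_disjoint)?) auto
    also have "(\<Prod>j\<in>A. ?w j) = u ^ a"
      using sub by simp
    also have "(\<Prod>j\<in>B. ?w j) = (\<Prod>j\<in>B. v)"
      using sub by (intro prod.cong) auto
    also have "(\<Prod>j\<in>J - A - B. ?w j) = (1 - u - v) ^ card (J - A - B)"
      by simp
    also have "card (J - A - B) = ?n - a - b"
      using sub finAB by (subst card_Diff_subset; (subst card_Diff_subset)?) auto
    finally show ?thesis using sub by simp
  qed
  \<comment> \<open>Each \<open>g\<close> determines its two sets, so at most one term of the double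
    sum is nonzero; \<open>disj\<close> puts the second set inside \<open>J - A\<close>.\<close>
  have "indicator {g. card {j\<in>J. P (g j)} = a \<and> card {j\<in>J. Q (g j)} = b} g =
      (\<Sum>A\<in>S J a. \<Sum>B\<in>S (J - A) b. indicator (E A B) g :: real)" for g
  proof -
    let ?A = "{j\<in>J. P (g j)}" and ?B = "{j\<in>J. Q (g j)}"
    have "?B \<subseteq> J - ?A" using disj by auto
    have "(\<Sum>A\<in>S J a. \<Sum>B\<in>S (J - A) b. indicator (E A B) g) =
        (\<Sum>A\<in>S J a. if A = ?A then \<Sum>B\<in>S (J - ?A) b. if B = ?B then 1 else 0 else (0 :: real))"
      by (intro sum.cong refl) (auto simp: E_def indicator_def intro!: sum.neutral sum.cong)
    also have "\<dots> = (if ?A \<in> S J a \<and> ?B \<in> S (J - ?A) b then 1 else 0)"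
      using fin finS by (simp add: sum.delta')
    also have "\<dots> = indicator {g. card {j\<in>J. P (g j)} = a \<and> card {j\<in>J. Q (g j)} = b} g"
      using \<open>?B \<subseteq> J - ?A\<close> by (auto simp: S_def indicator_def)
    finally show ?thesis by simp
  qed
  note count = this
  have int: "integrable ?Pi (indicator (E A B) :: _ \<Rightarrow> real)" for A B
    by (simp add: measure_pmf.emeasure_eq_measure)
  have "?lhs = measure_pmf.expectation ?Pi
      (indicator {g. card {j\<in>J. P (g j)} = a \<and> card {j\<in>J. Q (g j)} = b})"
    by simp
  also have "\<dots> = measure_pmf.expectation ?Pi (\<lambda>g. \<Sum>A\<in>S J a. \<Sum>B\<in>S (J - A) b. indicator (E A B) g)"
    by (intro Bochner_Integration.integral_cong refl count)
  also have "\<dots> = (\<Sum>A\<in>S J a. \<Sum>B\<in>S (J - A) b. measure_pmf.prob ?Pi (E A B))"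
    by (simp add: Bochner_Integration.integral_sum Bochner_Integration.integrable_sum int)
  also have "\<dots> = (\<Sum>A\<in>S J a. \<Sum>B\<in>S (J - A) b. u ^ a * v ^ b * (1 - u - v) ^ (?n - a - b))"
    using E by (intro sum.cong) auto
  also have "\<dots> = (\<Sum>A\<in>S J a. real ((?n - a) choose b) * (u ^ a * v ^ b * (1 - u - v) ^ (?n - a - b)))"
    using fin by (intro sum.cong) (auto simp: S_def n_subsets card_Diff_subset finite_subset)
  also have "\<dots> = real (?n choose a) * real ((?n - a) choose b) * (u ^ a * v ^ b * (1 - u - v) ^ (?n - a - b))"
    using fin by (simp add: S_def n_subsets)
  also have "real (?n choose a) * real ((?n - a) choose b) =
      (if a + b \<le> ?n then fact ?n / (fact a * fact b * fact (?n - a - b)) else 0)"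
  proof (cases "a + b \<le> ?n")
    case True
    then show ?thesis by (simp add: binomial_fact field_simps)
  next
    case False
    \<comment> \<open>If \<open>a\<close> exceeds \<open>card J\<close> the first binomial
      coefficient vanishes, otherwise the second does.\<close>
    then show ?thesis by (cases "a \<le> ?n") (auto simp: binomial_eq_0)
  qed
  finally show ?thesis by (simp add: mult_ac)
qed

text \<open>On \<open>a + b = k\<close> the trinomial coefficient factors as
  \<open>(n choose k) * (k choose a)\<close>, and the binomial theorem sums over \<open>a\<close> to
  \<open>(u + v) ^ k\<close>.\<close>

lemma trinomial_sum_binomial:
  fixes Q :: "(nat \<times> nat) pmf"
  assumes Q: "\<And>a b. pmf Q (a, b) = (if a + b \<le> n
     then fact n / (fact a * fact b * fact (n - a - b))
       * u ^ a * v ^ b * (1 - u - v) ^ (n - a - b) else 0)"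
    and uv: "0 \<le> u + v" "u + v \<le> 1"
  shows "map_pmf (\<lambda>(a, b). a + b) Q = binomial_pmf n (u + v)"
proof (rule pmf_eqI)
  fix k
  have "pmf (map_pmf (\<lambda>(a, b). a + b) Q) k = measure_pmf.prob Q ((\<lambda>a. (a, k - a)) ` {..k})"
    unfolding pmf_map
    by (rule arg_cong[where f = "measure_pmf.prob Q"]) (force simp: image_iff)
  also have "\<dots> = (\<Sum>a\<le>k. pmf Q (a, k - a))"
    by (subst measure_measure_pmf_finite) (auto simp: sum.reindex inj_on_def)
  also have "\<dots> = pmf (binomial_pmf n (u + v)) k"
  proof (cases "k \<le> n")
    case True
    have "(\<Sum>a\<le>k. pmf Q (a, k - a)) =
        (\<Sum>a\<le>k. real (n choose k) * (1 - u - v) ^ (n - k) * (real (k choose a) * u ^ a * v ^ (k - a)))"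
      using True by (intro sum.cong) (auto simp: Q binomial_fact field_simps)
    also have "\<dots> = real (n choose k) * (1 - u - v) ^ (n - k) * (u + v) ^ k"
      by (simp add: binomial_ring sum_distrib_left)
    finally show ?thesis
      using uv by (simp add: diff_diff_eq mult_ac)
  next
    case False
    then show ?thesis using uv by (auto simp: Q binomial_eq_0)
  qed
  finally show "pmf (map_pmf (\<lambda>(a, b). a + b) Q) k = pmf (binomial_pmf n (u + v)) k" .
qed

text \<open>The probability generating function of the binomial law; its value at 1/2 supplies the
  mean in the Jensen bound.\<close>

lemma expectation_binomial_power:
  assumes "0 \<le> q" "q \<le> 1"
  shows "measure_pmf.expectation (binomial_pmf n q) (\<lambda>k. x ^ k :: real) = (1 - q + q * x) ^ n"
proof -
  have "(1 - q + q * x) ^ n = (q * x + (1 - q)) ^ n" by (simp add: add.commute)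
  also have "\<dots> = (\<Sum>k\<le>n. real (n choose k) * (q * x) ^ k * (1 - q) ^ (n - k))"
    by (rule binomial_ring)
  finally show ?thesis
    using assms by (simp add: expectation_binomial_pmf' power_mult_distrib mult_ac)
qed

text \<open>Jensen's inequality. Odd powers above the first are convex only on the nonnegative
  half-line, hence the sign condition on \<open>f\<close>.\<close>

lemma expectation_power_ge:
  fixes f :: "'a \<Rightarrow> real"
  assumes fin: "finite (set_pmf p)" and nonneg: "\<And>x. x \<in> set_pmf p \<Longrightarrow> 0 \<le> f x"
  shows "measure_pmf.expectation p f ^ m \<le> measure_pmf.expectation p (\<lambda>x. f x ^ m)"
proof -
  have "convex_on {0::real..} (\<lambda>x. x ^ m)"
    using convex_power_odd[of m] convex_on_subset[OF convex_power_even[of m]] by (cases "even m") auto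
  from convex_on_sum[OF fin set_pmf_not_empty this sum_pmf_eq_1[OF fin order.refl],
      of f] nonneg fin
  show ?thesis by (simp add: integral_measure_pmf[where A = "set_pmf p"])
qed

section \<open>Channel uses that trigger a discard\<close>

definition symbol_pmf :: "real \<Rightarrow> nat pmf" where
  "symbol_pmf \<nu> = map_pmf of_bool (bernoulli_pmf \<nu>)"

text \<open>For finite \<open>T\<close> these are the uses with output 0; the range starts at 2 to
  leave out the pilot.\<close>

definition zero_uses :: "nat \<Rightarrow> nat set \<Rightarrow> (nat \<Rightarrow> nat \<Rightarrow> nat) \<Rightarrow> nat set" where
  "zero_uses n0 T c = {j\<in>{2..n0 + 1}. \<forall>i\<in>T. c i j = 0}"

definition one_uses :: "nat \<Rightarrow> nat set \<Rightarrow> (nat \<Rightarrow> nat \<Rightarrow> nat) \<Rightarrow> nat set" where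
  "one_uses n0 T c = {j\<in>{2..n0 + 1}. \<forall>i\<in>T. c i j = 1}"

text \<open>The words that pass both discarding rules. The inequalities mirror the rules, which
  forbid a symbol rather than prescribe one, and make this a product set over the channel
  uses.\<close>

definition compatible :: "nat \<Rightarrow> nat set \<Rightarrow> (nat \<Rightarrow> nat \<Rightarrow> nat) \<Rightarrow> (nat \<Rightarrow> nat) set" where
  "compatible n0 T c =
     {d. (\<forall>j\<in>zero_uses n0 T c. d j \<noteq> 1) \<and> (\<forall>j\<in>one_uses n0 T c. d j \<noteq> 0)}"

section \<open>Association of a codeword with a slot\<close>

lemma mean_degree_eq_sum: "mean_degree N \<Lambda> = (\<Sum>L=1..N. real L * pmf \<Lambda> L)"
  using higher_pderiv_sum[of 1 "\<lambda>L. monom (pmf \<Lambda> L) L" "{1..N}"]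
  by (simp add: mean_degree_def degree_poly_def poly_sum pderiv_monom poly_monom)

text \<open>Given degree \<open>L\<close>, the slot lies in \<open>(N - 1) choose (L - 1)\<close> of
  the \<open>N choose L\<close> equally likely sets, a fraction \<open>L / N\<close>; averaging over
  \<open>L\<close> yields the mean degree.\<close>

lemma prob_slots_pmf:
  assumes "set_pmf \<Lambda> \<subseteq> {1..N}" "s \<in> {1..N}"
  shows "measure_pmf.prob (slots_pmf N \<Lambda>) {A. s \<in> A} = mean_degree N \<Lambda> / real N"
proof -
  have uniform: "measure_pmf.prob (pmf_of_set {A. A \<subseteq> {1..N} \<and> card A = L}) {A. s \<in> A} =
      real L / real N" if L: "L \<in> {1..N}" for L
  proof -
    define F where "F = (\<lambda>X k. {A. A \<subseteq> (X :: nat set) \<and> card A = k})"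
    have card_F: "card (F X k) = card X choose k" if "finite X" for X k
      using that by (simp add: F_def n_subsets)
    have pos: "card (F {1..N} L) > 0"
      using L by (simp add: card_F)
    then have "F {1..N} L \<noteq> {}" "finite (F {1..N} L)"
      using card_gt_0_iff by blast+
    then have "measure_pmf.prob (pmf_of_set (F {1..N} L)) {A. s \<in> A} =
        real (card (F {1..N} L \<inter> {A. s \<in> A})) / real (N choose L)"
      by (simp add: measure_pmf_of_set card_F)
    also have "F {1..N} L \<inter> {A. s \<in> A} = insert s ` F ({1..N} - {s}) (L - 1)"
    proof (intro equalityI subsetI)
      fix A assume A: "A \<in> F {1..N} L \<inter> {A. s \<in> A}"
      then have "finite A" using finite_subset by (auto simp: F_def)
      with A have "A - {s} \<in> F ({1..N} - {s}) (L - 1)" "A = insert s (A - {s})"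
        by (auto simp: F_def)
      then show "A \<in> insert s ` F ({1..N} - {s}) (L - 1)" by blast
    next
      fix A assume "A \<in> insert s ` F ({1..N} - {s}) (L - 1)"
      then obtain B where B: "A = insert s B" "B \<subseteq> {1..N} - {s}" "card B = L - 1"
        by (auto simp: F_def)
      then have "finite B" using finite_subset by blast
      moreover have "s \<notin> B" using B by auto
      ultimately show "A \<in> F {1..N} L \<inter> {A. s \<in> A}"
        using B L assms(2) by (auto simp: F_def)
    qed
    also have "card (insert s ` F ({1..N} - {s}) (L - 1)) = card (F ({1..N} - {s}) (L - 1))"
      by (rule card_image) (auto simp: inj_on_def F_def)
    also have "\<dots> = (N - 1) choose (L - 1)"
      using assms(2) by (simp add: card_F)
    also have "real ((N - 1) choose (L - 1)) / real (N choose L) = real L / real N"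
    proof -
      have "L * (N choose L) = N * ((N - 1) choose (L - 1))"
        using L times_binomial_minus1_eq by simp
      then have "real L * real (N choose L) = real N * real ((N - 1) choose (L - 1))"
        by (metis of_nat_mult)
      moreover have "real (N choose L) > 0" using L by simp
      ultimately show ?thesis using L by (simp add: field_simps)
    qed
    finally show ?thesis by (simp add: F_def)
  qed
  have "measure_pmf.prob (slots_pmf N \<Lambda>) {A. s \<in> A} = (\<Sum>L=1..N. pmf \<Lambda> L * (real L / real N))"
    unfolding slots_pmf_def measure_bind_pmf
    using assms(1) uniform
    by (subst integral_measure_pmf[where A = "{1..N}"]) (auto intro!: sum.cong simp del: One_nat_def)
  also have "\<dots> = (\<Sum>L=1..N. real L * pmf \<Lambda> L) / real N"
    by (simp add: sum_divide_distrib mult_ac)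
  also have "(\<Sum>L=1..N. real L * pmf \<Lambda> L) = mean_degree N \<Lambda>"
    by (simp only: mean_degree_eq_sum)
  finally show ?thesis .
qed

text \<open>Guarantees that the conditioning event in \<open>resolve_prob\<close> has positive
  probability.\<close>

lemma mean_degree_pos:
  assumes "set_pmf \<Lambda> \<subseteq> {1..N}"
  shows "0 < mean_degree N \<Lambda>"
proof -
  obtain L where L: "L \<in> set_pmf \<Lambda>" using set_pmf_not_empty by fast
  have "mean_degree N \<Lambda> = (\<Sum>L=1..N. real L * pmf \<Lambda> L)"
    by (rule mean_degree_eq_sum)
  also have "\<dots> > 0"
    using L assms by (intro sum_pos2[of _ L]) (auto simp: pmf_positive)
  finally show ?thesis .
qed

section \<open>Symbols of a random codeword\<close>

lemma finite_set_codeword_pmf: "finite (set_pmf (codeword_pmf n0 \<nu>))"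
  unfolding codeword_pmf_def by (rule finite_set_Pi_pmf) auto

lemma set_codeword_pmf:
  assumes "d \<in> set_pmf (codeword_pmf n0 \<nu>)"
  shows "d 1 = 1" "d j \<in> {0, 1}"
proof -
  have in_range: "d j \<in> set_pmf (if j = 1 then return_pmf 1 else map_pmf of_bool (bernoulli_pmf \<nu>))"
    if "j \<in> {1..n0 + 1}" for j
    using assms that unfolding codeword_pmf_def by (auto simp: set_Pi_pmf PiE_dflt_def)
  show "d 1 = 1" using in_range[of 1] by simp
  show "d j \<in> {0, 1}"
  proof (cases "j \<in> {1..n0 + 1}")
    case True
    then show ?thesis using in_range[OF True] by (auto split: if_splits)
  next
    \<comment> \<open>Outside the index range the product law puts its default value 0, which is
      again a bit.\<close>
    case False
    then show ?thesis using assms by (simp add: codeword_pmf_def set_Pi_pmf PiE_dflt_def)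
  qed
qed

lemma prob_symbol_pmf:
  assumes "0 < \<nu>" "\<nu> < 1"
  shows "measure_pmf.prob (symbol_pmf \<nu>) {x. x \<noteq> 0} = \<nu>"
    "measure_pmf.prob (symbol_pmf \<nu>) {x. x \<noteq> 1} = 1 - \<nu>"
    "measure_pmf.prob (symbol_pmf \<nu>) {1} = \<nu>"
    "measure_pmf.prob (symbol_pmf \<nu>) {0} = 1 - \<nu>"
proof -
  have "{b. b} = {True}" "{b. \<not> b} = {False}" by auto
  then show "measure_pmf.prob (symbol_pmf \<nu>) {x. x \<noteq> 0} = \<nu>"
    "measure_pmf.prob (symbol_pmf \<nu>) {x. x \<noteq> 1} = 1 - \<nu>"
    "measure_pmf.prob (symbol_pmf \<nu>) {1} = \<nu>"
    "measure_pmf.prob (symbol_pmf \<nu>) {0} = 1 - \<nu>"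
    using assms by (simp_all add: symbol_pmf_def vimage_def measure_measure_pmf_finite)
qed

lemma codeword_pmf_eq:
  "codeword_pmf n0 \<nu> =
    Pi_pmf {1..n0 + 1} 0 (\<lambda>j. if j = 1 then return_pmf 1 else symbol_pmf \<nu>)"
  unfolding codeword_pmf_def symbol_pmf_def ..

text \<open>The symbols are independent, and each use in one of the two sets forces one bit.
  Nonempty \<open>T\<close> makes the sets disjoint, and the pilot lies in neither.\<close>

lemma prob_compatible:
  assumes "0 < \<nu>" "\<nu> < 1" and "T \<noteq> {}"
  shows "measure_pmf.prob (codeword_pmf n0 \<nu>) (compatible n0 T c) =
    \<nu> ^ card (one_uses n0 T c) * (1 - \<nu>) ^ card (zero_uses n0 T c)"
proof -
  let ?Z = "zero_uses n0 T c" and ?O = "one_uses n0 T c"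
  let ?F = "\<lambda>j. if j \<in> ?Z then {x. x \<noteq> 1} else if j \<in> ?O then {x. x \<noteq> 0} else (UNIV :: nat set)"
  \<comment> \<open>At most one of the two factors differs from 1, so the product over all uses
    splits into one product per set.\<close>
  let ?w = "\<lambda>j. (if j \<in> ?O then \<nu> else 1) * (if j \<in> ?Z then 1 - \<nu> else 1)"
  have disj: "?Z \<inter> ?O = {}" and sub: "?Z \<subseteq> {1..n0 + 1}" "?O \<subseteq> {1..n0 + 1}"
    and pilot: "1 \<notin> ?Z" "1 \<notin> ?O"
    using assms(3) by (auto simp: zero_uses_def one_uses_def)
  have "compatible n0 T c = Pi {1..n0 + 1} ?F"
    using disj sub unfolding compatible_def Pi_def
    by (auto simp del: atLeastAtMost_iff split: if_splits)
  then have "measure_pmf.prob (codeword_pmf n0 \<nu>) (compatible n0 T c) =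
      (\<Prod>j\<in>{1..n0 + 1}. measure_pmf.prob
        (if j = 1 then return_pmf 1 else symbol_pmf \<nu>) (?F j))"
    by (simp only: codeword_pmf_eq measure_Pi_pmf_Pi finite_atLeastAtMost)
  also have "\<dots> = (\<Prod>j\<in>{1..n0 + 1}. ?w j)"
    using disj pilot prob_symbol_pmf[OF assms(1,2)] by (intro prod.cong) auto
  also have "\<dots> = (\<Prod>j\<in>?O. \<nu>) * (\<Prod>j\<in>?Z. 1 - \<nu>)"
    unfolding prod.distrib using sub
    by (intro arg_cong2[where f = "(*)"] prod.mono_neutral_cong_right) auto
  finally show ?thesis by simp
qed

section \<open>The decoder and its success probability\<close>

text \<open>A sum of \<open>card T\<close> bits equals 0 or \<open>card T\<close> only if all bits
  agree, so discards happen exactly at the zero and one uses. Transmitted codewords always survive,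
  so the count is right iff no other candidate does.\<close>

lemma resolved_iff_compatible:
  assumes c: "\<And>i. i \<in> {1..M} \<Longrightarrow> c i \<in> set_pmf (codeword_pmf n0 \<nu>)"
    and T: "T \<subseteq> {1..M}" "T \<noteq> {}" and S: "\<forall>i\<in>T. s \<in> S i"
  shows "resolved n0 M T s c S \<longleftrightarrow> (\<forall>i\<in>{1..M} - T. \<not> (s \<in> S i \<and> c i \<in> compatible n0 T c))"
proof -
  have finT: "finite T" using T finite_subset by blast
  have bin: "c i j \<in> {0, 1}" and pilot: "c i 1 = 1" if "i \<in> T" for i j
    using set_codeword_pmf[OF c, of i] that T(1) by blast+
  have y1: "received c T 1 = card T"
    using pilot by (simp add: received_def)
  have zero: "received c T j = 0 \<longleftrightarrow> (\<forall>i\<in>T. c i j = 0)" for j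
    using finT by (simp add: received_def)
  have one: "received c T j = card T \<longleftrightarrow> (\<forall>i\<in>T. c i j = 1)" for j
  proof
    assume "received c T j = card T"
    moreover have "c i j \<le> 1" if "i \<in> T" for i
      using bin[OF that, of j] by auto
    \<comment> \<open>The deficits \<open>1 - c i j\<close> sum to 0, hence all vanish; the bound by
      1 keeps natural subtraction exact.\<close>
    ultimately have "(\<Sum>i\<in>T. 1 - c i j) = 0"
      using sum_subtractf_nat[of T "\<lambda>i. c i j" "\<lambda>_. 1"] by (simp add: received_def)
    then have "1 \<le> c i j" if "i \<in> T" for i
      using that finT by simp
    with \<open>\<And>i. i \<in> T \<Longrightarrow> c i j \<le> 1\<close> show "\<forall>i\<in>T. c i j = 1"
      by (simp add: le_antisym)
  qed (simp add: received_def)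
  have surv: "survivors n0 c (candidates M S s) (received c T) =
      {i\<in>{1..M}. s \<in> S i \<and> c i \<in> compatible n0 T c}" (is "?V = _")
    by (auto simp: survivors_def candidates_def compatible_def zero_uses_def one_uses_def
        y1[simplified] zero one)
  have "T \<subseteq> ?V"
    unfolding surv using T S by (auto simp: compatible_def zero_uses_def one_uses_def)
  moreover have "finite ?V"
    unfolding surv by simp
  ultimately have "card ?V = card T \<longleftrightarrow> ?V = T"
    using card_subset_eq by metis
  also have "\<dots> \<longleftrightarrow> ?V - T = {}"
    using \<open>T \<subseteq> ?V\<close> by auto
  finally show ?thesis
    unfolding resolved_def surv by auto
qed

lemma resolve_prob_eq_expectation:
  assumes nu: "0 < \<nu>" "\<nu> < 1" and \<Lambda>: "set_pmf \<Lambda> \<subseteq> {1..N}"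
    and T: "T \<subseteq> {1..M}" "T \<noteq> {}" and s: "s \<in> {1..N}"
  shows "resolve_prob n0 N M \<nu> \<Lambda> T s =
    measure_pmf.expectation (Pi_pmf T (\<lambda>_. 0) (\<lambda>_. codeword_pmf n0 \<nu>))
      (\<lambda>c. (1 - mean_degree N \<Lambda> / real N * \<nu> ^ card (one_uses n0 T c)
              * (1 - \<nu>) ^ card (zero_uses n0 T c)) ^ (M - card T))"
proof -
  define p where "p = mean_degree N \<Lambda> / real N"
  define R where "R = {1..M} - T"
  let ?W = "codeword_pmf n0 \<nu>" and ?L = "slots_pmf N \<Lambda>"
  let ?C = "\<lambda>I. Pi_pmf I (\<lambda>_. 0) (\<lambda>_. ?W)"
  let ?S = "Pi_pmf {1..M} {} (\<lambda>_. ?L)"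
  have finT: "finite T" using T finite_subset by blast
  have finC: "finite (set_pmf (?C I))" if "finite I" for I
    using that finite_set_codeword_pmf by (intro finite_set_Pi_pmf) auto
  have split: "{1..M} = T \<union> R" "T \<inter> R = {}" "finite R"
    using T by (auto simp: R_def)
  have cardR: "card R = M - card T"
    using T finT by (simp add: R_def card_Diff_subset)
  have p: "measure_pmf.prob ?L {A. s \<in> A} = p"
    using prob_slots_pmf[OF \<Lambda> s] by (simp add: p_def)
  have "p > 0"
    using mean_degree_pos[OF \<Lambda>] s by (simp add: p_def)
  have "p \<le> 1"
    using p measure_pmf.prob_le_1 by metis
  have p': "measure_pmf.prob ?L {A. s \<notin> A} = 1 - p"
    using measure_pmf.prob_compl[of "{A. s \<in> A}" ?L] p by (simp add: set_diff_eq)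
  \<comment> \<open>\<open>K\<close> will be the set of indices of compatible codewords, which is
    fixed once the codebook is. Only indices in both \<open>R\<close> and \<open>K\<close> must
    avoid the slot.\<close>
  have slots: "measure_pmf.prob ?S {S. (\<forall>i\<in>T. s \<in> S i) \<and> (\<forall>i\<in>R. \<not> (s \<in> S i \<and> i \<in> K))} =
      p ^ card T * (\<Prod>i\<in>R. if i \<in> K then 1 - p else 1)" for K
  proof -
    let ?F = "\<lambda>i. if i \<in> T then {A. s \<in> A} else if i \<in> K then {A. s \<notin> A} else UNIV"
    have "{S. (\<forall>i\<in>T. s \<in> S i) \<and> (\<forall>i\<in>R. \<not> (s \<in> S i \<and> i \<in> K))} = Pi {1..M} ?F"
      using split(2) unfolding split(1) by (auto simp: Pi_def split: if_splits)
    then have "measure_pmf.prob ?S {S. (\<forall>i\<in>T. s \<in> S i) \<and> (\<forall>i\<in>R. \<not> (s \<in> S i \<and> i \<in> K))} =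
        (\<Prod>i\<in>T \<union> R. measure_pmf.prob ?L (?F i))"
      by (simp only: measure_Pi_pmf_Pi finite_atLeastAtMost flip: split(1))
    also have "\<dots> = (\<Prod>i\<in>T. measure_pmf.prob ?L (?F i)) * (\<Prod>i\<in>R. measure_pmf.prob ?L (?F i))"
      using finT split by (intro prod.union_disjoint)
    also have "(\<Prod>i\<in>T. measure_pmf.prob ?L (?F i)) = p ^ card T"
      using p by simp
    also have "(\<Prod>i\<in>R. measure_pmf.prob ?L (?F i)) = (\<Prod>i\<in>R. if i \<in> K then 1 - p else 1)"
      using p' split(2) by (intro prod.cong) auto
    finally show ?thesis .
  qed
  \<comment> \<open>With \<open>K\<close> empty only the requirement on \<open>T\<close> remains,
    which is the conditioning event.\<close>
  have cond: "measure_pmf.prob (system_pmf n0 N M \<nu> \<Lambda>) {\<omega>. \<forall>i\<in>T. s \<in> snd \<omega> i} = p ^ card T"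
    using slots[of "{}"] by (simp add: system_pmf_def measure_pair_pmf)
  \<comment> \<open>\<open>c\<close> supplies the transmitted rows and \<open>d\<close> the others.
    Separate arguments allow these to be drawn independently below; the diagonal
    \<open>?h c c\<close> is the integrand for a single codebook.\<close>
  let ?h = "\<lambda>c d. \<Prod>i\<in>R. 1 - p * indicator (compatible n0 T c) (d i)"
  have "measure_pmf.prob (system_pmf n0 N M \<nu> \<Lambda>)
      {\<omega>. resolved n0 M T s (fst \<omega>) (snd \<omega>) \<and> (\<forall>i\<in>T. s \<in> snd \<omega> i)} =
    measure_pmf.expectation (?C {1..M}) (\<lambda>c. measure_pmf.prob ?S
      {S. resolved n0 M T s c S \<and> (\<forall>i\<in>T. s \<in> S i)})"
    by (simp add: system_pmf_def measure_pair_pmf)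
  also have "\<dots> = measure_pmf.expectation (?C {1..M}) (\<lambda>c. p ^ card T * ?h c c)"
  \<comment> \<open>The criterion for resolution is available only for codebooks in the support,
    which are binary with pilot 1.\<close>
  proof (intro integral_cong_AE AE_pmfI)
    fix c assume "c \<in> set_pmf (?C {1..M})"
    then have "c i \<in> set_pmf ?W" if "i \<in> {1..M}" for i
      using that by (auto simp: set_Pi_pmf PiE_dflt_def)
    from resolved_iff_compatible[where c = c, OF this T]
    have "{S. resolved n0 M T s c S \<and> (\<forall>i\<in>T. s \<in> S i)} =
        {S. (\<forall>i\<in>T. s \<in> S i) \<and> (\<forall>i\<in>R. \<not> (s \<in> S i \<and> i \<in> {i. c i \<in> compatible n0 T c}))}"
      unfolding R_def by blast
    moreover have "(\<Prod>i\<in>R. if i \<in> {i. c i \<in> compatible n0 T c} then 1 - p else 1) = ?h c c"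
      by (intro prod.cong) auto
    ultimately show "measure_pmf.prob ?S {S. resolved n0 M T s c S \<and> (\<forall>i\<in>T. s \<in> S i)} =
        p ^ card T * ?h c c"
      by (simp only: slots)
  qed auto
  also have "\<dots> = p ^ card T * measure_pmf.expectation (?C {1..M}) (\<lambda>c. ?h c c)"
    by simp
  also have "measure_pmf.expectation (?C {1..M}) (\<lambda>c. ?h c c) =
      measure_pmf.expectation (pair_pmf (?C T) (?C R)) (\<lambda>(c, d). ?h c d)"
  proof -
    \<comment> \<open>Merging the rows of \<open>c\<close> on \<open>T\<close> with those of
      \<open>d\<close> elsewhere loses nothing: compatibility reads only rows in \<open>T\<close>,
      and the factors read only rows in \<open>R\<close>.\<close>
    have same: "compatible n0 T (\<lambda>i. if i \<in> T then c i else d i) = compatible n0 T c" for c d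
      by (simp add: compatible_def zero_uses_def one_uses_def)
    have other: "(\<Prod>i\<in>R. 1 - p * indicator X (if i \<in> T then c i else d i)) =
        (\<Prod>i\<in>R. 1 - p * indicator X (d i))" for X and c d :: "nat \<Rightarrow> nat \<Rightarrow> nat"
      using split(2) by (intro prod.cong) auto
    show ?thesis
      using finT split(2,3) unfolding split(1)
      by (subst Pi_pmf_union) (simp_all add: same other case_prod_unfold)
  qed
  also have "\<dots> = measure_pmf.expectation (?C T) (\<lambda>c. measure_pmf.expectation (?C R) (?h c))"
    using finC finT split(3) by (subst expectation_pair_pmf) auto
  also have "\<dots> = measure_pmf.expectation (?C T) (\<lambda>c.
      (1 - p * measure_pmf.prob ?W (compatible n0 T c)) ^ (M - card T))"
  proof (intro Bochner_Integration.integral_cong refl)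
    fix c
    have "measure_pmf.expectation (?C R) (?h c) =
        (\<Prod>i\<in>R. measure_pmf.expectation ?W (\<lambda>d. 1 - p * indicator (compatible n0 T c) d))"
      using split(3) \<open>0 < p\<close> \<open>p \<le> 1\<close> finite_set_codeword_pmf
      by (subst expectation_prod_Pi_pmf) (auto simp: indicator_def integrable_measure_pmf_finite)
    also have "measure_pmf.expectation ?W (\<lambda>d. 1 - p * indicator (compatible n0 T c) d) =
        1 - p * measure_pmf.prob ?W (compatible n0 T c)"
      by (subst Bochner_Integration.integral_diff)
        (auto simp: integrable_measure_pmf_finite finite_set_codeword_pmf)
    finally show "measure_pmf.expectation (?C R) (?h c) =
        (1 - p * measure_pmf.prob ?W (compatible n0 T c)) ^ (M - card T)"
      by (simp add: cardR)
  qed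
  \<comment> \<open>The factor \<open>p ^ card T\<close> cancels against the probability of the
    conditioning event.\<close>
  finally show ?thesis
    using \<open>p > 0\<close> unfolding resolve_prob_def cond_prob_def p_def[symmetric]
    by (simp add: cond prob_compatible[OF nu T(2)] mult.assoc)
qed

section \<open>Joint law of the two counts\<close>

text \<open>After transposition the columns are independent. Each of the \<open>n0\<close> columns
  after the pilot is all 0 with probability \<open>(1 - \<nu>) ^ card T\<close> and all 1 with
  probability \<open>\<nu> ^ card T\<close>; nonempty \<open>T\<close> makes these events exclusive,
  so the trinomial law applies.\<close>

lemma pmf_zero_one_uses:
  assumes nu: "0 < \<nu>" "\<nu> < 1" and T: "finite T" "T \<noteq> {}"
  shows "pmf (map_pmf (\<lambda>c. (card (zero_uses n0 T c), card (one_uses n0 T c)))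
      (Pi_pmf T (\<lambda>_. 0) (\<lambda>_. codeword_pmf n0 \<nu>))) (a, b) =
    (if a + b \<le> n0
     then fact n0 / (fact a * fact b * fact (n0 - a - b))
       * (1 - \<nu>) ^ (card T * a) * \<nu> ^ (card T * b)
       * (1 - (1 - \<nu>) ^ card T - \<nu> ^ card T) ^ (n0 - a - b) else 0)"
proof -
  let ?q = "\<lambda>j. if j = 1 then return_pmf 1 else symbol_pmf \<nu>"
  let ?col = "\<lambda>j. Pi_pmf T 0 (\<lambda>_. ?q j)"
  let ?P = "\<lambda>x. \<forall>i\<in>T. x i = (0 :: nat)" and ?Q = "\<lambda>x. \<forall>i\<in>T. x i = (1 :: nat)"
  have column: "measure_pmf.prob (?col j) {x. \<forall>i\<in>T. x i = k} =
      measure_pmf.prob (symbol_pmf \<nu>) {k} ^ card T" if "j \<in> {2..n0 + 1}" for j k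
  proof -
    have "{x. \<forall>i\<in>T. x i = k} = Pi T (\<lambda>_. {k})" by auto
    then show ?thesis using T that by (simp add: measure_Pi_pmf_Pi)
  qed
  have transposed: "map_pmf (\<lambda>c j i. c i j) (Pi_pmf T (\<lambda>_. 0) (\<lambda>_. codeword_pmf n0 \<nu>)) =
      Pi_pmf {1..n0 + 1} (\<lambda>_. 0) ?col"
    using T(1) by (simp only: codeword_pmf_eq Pi_pmf_transpose finite_atLeastAtMost)
  have "pmf (map_pmf (\<lambda>c. (card (zero_uses n0 T c), card (one_uses n0 T c)))
      (Pi_pmf T (\<lambda>_. 0) (\<lambda>_. codeword_pmf n0 \<nu>))) (a, b) =
    measure_pmf.prob (map_pmf (\<lambda>c j i. c i j) (Pi_pmf T (\<lambda>_. 0) (\<lambda>_. codeword_pmf n0 \<nu>)))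
      {g. card {j\<in>{2..n0 + 1}. ?P (g j)} = a \<and> card {j\<in>{2..n0 + 1}. ?Q (g j)} = b}"
    by (simp add: pmf_map vimage_def zero_uses_def one_uses_def)
  also have "\<dots> = (if a + b \<le> card {2..n0 + 1}
     then fact (card {2..n0 + 1}) / (fact a * fact b * fact (card {2..n0 + 1} - a - b))
       * ((1 - \<nu>) ^ card T) ^ a * (\<nu> ^ card T) ^ b
       * (1 - (1 - \<nu>) ^ card T - \<nu> ^ card T) ^ (card {2..n0 + 1} - a - b) else 0)"
    unfolding transposed
    by (rule trinomial_Pi_pmf) (use T column prob_symbol_pmf[OF nu] in auto)
  finally show ?thesis by (simp flip: power_mult)
qed

section \<open>The general formula and the symmetric case\<close>

theorem theorem1:
  fixes n0 N M U s :: nat and T :: "nat set" and \<nu> :: real and \<Lambda> :: "nat pmf"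
  assumes "n0 > 0" and "N > 0" and "M > 0" and "U > 0" and "U \<le> M"
    and "0 < \<nu>" and "\<nu> < 1"
    and "set_pmf \<Lambda> \<subseteq> {1..N}"
    and "T \<subseteq> {1..M}" and "card T = U"
    and "s \<in> {1..N}"
  shows "(\<exists>Q :: (nat \<times> nat) pmf.
            (\<forall>A0 AU. pmf Q (A0, AU) =
               (if A0 + AU \<le> n0
                then fact n0 / (fact A0 * fact AU * fact (n0 - A0 - AU))
                       * (1 - \<nu>) ^ (U * A0) * \<nu> ^ (U * AU)
                       * (1 - (1 - \<nu>) ^ U - \<nu> ^ U) ^ (n0 - A0 - AU)
                else 0)) \<and>
            resolve_prob n0 N M \<nu> \<Lambda> T s =
              measure_pmf.expectation Q
                (\<lambda>(A0, AU). (1 - mean_degree N \<Lambda> / real N * \<nu> ^ AU * (1 - \<nu>) ^ A0) ^ (M - U))) \<and>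
         (\<nu> = 1 / 2 \<longrightarrow>
            resolve_prob n0 N M \<nu> \<Lambda> T s =
              measure_pmf.expectation (binomial_pmf n0 (2 powi (1 - int U)))
                (\<lambda>A. (1 - mean_degree N \<Lambda> / real N * 2 powi (- int A)) ^ (M - U)) \<and>
            resolve_prob n0 N M \<nu> \<Lambda> T s \<ge>
              (1 - mean_degree N \<Lambda> / real N * (1 - 2 powi (- int U)) ^ n0) ^ (M - U))"
proof -
  have T: "finite T" "T \<noteq> {}"
    using assms(4,10) card_gt_0_iff by blast+
  define p where "p = mean_degree N \<Lambda> / real N"
  \<comment> \<open>The prescribed masses determine \<open>Q\<close> completely, so the existential
    statement pins down the joint law of the counts.\<close>
  define Q where "Q = map_pmf (\<lambda>c. (card (zero_uses n0 T c), card (one_uses n0 T c)))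
      (Pi_pmf T (\<lambda>_. 0) (\<lambda>_. codeword_pmf n0 \<nu>))"
  have Q: "pmf Q (a, b) = (if a + b \<le> n0
     then fact n0 / (fact a * fact b * fact (n0 - a - b))
       * (1 - \<nu>) ^ (U * a) * \<nu> ^ (U * b) * (1 - (1 - \<nu>) ^ U - \<nu> ^ U) ^ (n0 - a - b) else 0)" for a b
    unfolding Q_def pmf_zero_one_uses[OF assms(6,7) T] assms(10) ..
  have resolve: "resolve_prob n0 N M \<nu> \<Lambda> T s =
      measure_pmf.expectation Q (\<lambda>(a, b). (1 - p * \<nu> ^ b * (1 - \<nu>) ^ a) ^ (M - U))"
    by (simp add: resolve_prob_eq_expectation[OF assms(6-9) T(2) assms(11)] Q_def p_def assms(10))
  have "resolve_prob n0 N M \<nu> \<Lambda> T s =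
      measure_pmf.expectation (binomial_pmf n0 (2 powi (1 - int U))) (\<lambda>A. (1 - p * 2 powi (- int A)) ^ (M - U))
    \<and> (1 - p * (1 - 2 powi (- int U)) ^ n0) ^ (M - U) \<le> resolve_prob n0 N M \<nu> \<Lambda> T s"
    if nu: "\<nu> = 1 / 2"
  proof -
    \<comment> \<open>The chance that a column is constant: all 0 and all 1 are equally likely for
      \<nu> = 1/2.\<close>
    define q :: real where "q = (1 / 2) ^ U + (1 / 2) ^ U"
    obtain V where V: "U = Suc V"
      using assms(4) gr0_implies_Suc by blast
    have half: "2 powi (- int k) = (1 / 2 :: real) ^ k" for k
      by (simp add: power_int_minus power_one_over inverse_eq_divide)
    have q_eq: "q = 2 powi (1 - int U)"
      using half[of V] by (simp add: q_def V)
    have q: "0 \<le> q" "q \<le> 1"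
      by (auto simp: q_def V power_le_one)
    have bin: "map_pmf (\<lambda>(a, b). a + b) Q = binomial_pmf n0 q"
      unfolding q_def using q
      by (intro trinomial_sum_binomial) (auto simp: Q nu q_def power_mult)
    have p: "0 < p" "p \<le> 1"
      using mean_degree_pos[OF assms(8)] assms(2) prob_slots_pmf[OF assms(8,11)]
        measure_pmf.prob_le_1[of "slots_pmf N \<Lambda>" "{A. s \<in> A}"]
      by (auto simp: p_def)
    have "resolve_prob n0 N M \<nu> \<Lambda> T s =
        measure_pmf.expectation (map_pmf (\<lambda>(a, b). a + b) Q) (\<lambda>A. (1 - p * (1 / 2) ^ A) ^ (M - U))"
      unfolding resolve by (simp add: nu power_add case_prod_unfold mult_ac)
    then have eq: "resolve_prob n0 N M \<nu> \<Lambda> T s =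
        measure_pmf.expectation (binomial_pmf n0 q) (\<lambda>A. (1 - p * (1 / 2) ^ A) ^ (M - U))"
      by (simp add: bin)
    \<comment> \<open>The sign condition for Jensen, which follows from
      \<open>p \<le> 1\<close>.\<close>
    have nonneg: "0 \<le> 1 - p * (1 / 2) ^ A" for A
      using p mult_le_one[of p "(1 / 2) ^ A"] by (simp add: power_le_one)
    have fin: "finite (set_pmf (binomial_pmf n0 q))"
      using q by (simp add: set_pmf_binomial_eq)
    have "measure_pmf.expectation (binomial_pmf n0 q) (\<lambda>A. 1 - p * (1 / 2) ^ A) =
        1 - p * measure_pmf.expectation (binomial_pmf n0 q) (\<lambda>A. (1 / 2) ^ A)"
      using fin by (subst Bochner_Integration.integral_diff) (auto simp: integrable_measure_pmf_finite)
    \<comment> \<open>The generating function at 1/2 has base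
      \<open>1 - q + q / 2 = 1 - q / 2\<close>, and \<open>q / 2\<close> is
      \<open>(1 / 2) ^ U\<close>.\<close>
    also have "\<dots> = 1 - p * (1 - 2 powi (- int U)) ^ n0"
      unfolding expectation_binomial_power[OF q] half by (simp add: q_def)
    finally have mean: "measure_pmf.expectation (binomial_pmf n0 q) (\<lambda>A. 1 - p * (1 / 2) ^ A) =
        1 - p * (1 - 2 powi (- int U)) ^ n0" .
    have "(1 - p * (1 - 2 powi (- int U)) ^ n0) ^ (M - U) \<le> resolve_prob n0 N M \<nu> \<Lambda> T s"
      unfolding eq mean[symmetric] by (rule expectation_power_ge[OF fin nonneg])
    with eq show ?thesis
      unfolding half q_eq[symmetric] by blast
  qed
  with Q resolve show ?thesis
    unfolding p_def by (intro conjI exI[of _ Q] allI impI) blast+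
qed

end
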